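(* Let $\alpha=\{\alpha_k\}_{k=0}^\infty$ be a sequence of real numbers and let $n\in\mathbb{N}$. Define the operator $V_\alpha$ on polynomials by $V_\alpha(\sum_{k=0}^n a_kz^k)=\sum_{k=0}^n c_kz^k$, where $c_k=\sum_{j=0}^\infty\alpha_ja_{k-j}a_{k+1+j}$ and $a_j=0$ for $j\notin\{0,\dots,n\}$. The following are equivalent: (i) $V_\alpha(\mathcal{P}^+_n)\subseteq\mathcal{P}^+_n\cup\{0\}$; (ii) $V_\alpha((1+z)^n)\in\mathcal{P}^+_n\cup\{0\}$; (iii) $$\sum_{k=0}^{\lfloor (n-1)/2\rfloor}\left(\sum_{j=0}^k\frac{\alpha_j}{(k+1+j)!(k-j)!}\right)\frac{z^k}{(n-2k-1)!}\in\mathcal{P}^+_n\cup\{0\}.$$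
   Context: $\mathcal{P}^+_n$ denotes the set of all (nonzero) polynomials of degree at most $n$ with only real and non-positive zeros. *)

theory Defs
  imports Complex_Main "HOL-Computational_Algebra.Polynomial"
begin

text \<open>
  The set \<open>\<P>\<^sup>+\<^sub>n\<close>. Coefficients are complex, so that the quantification over zeros is over all
  complex zeros; non-zero constants belong to the set, having no zeros.
\<close>

definition P_plus :: "nat \<Rightarrow> complex poly set" where
  "P_plus n = {p. p \<noteq> 0 \<and> degree p \<le> n \<and> (\<forall>z. poly p z = 0 \<longrightarrow> z \<in> \<real> \<and> Re z \<le> 0)}"

text \<open>Coefficients indexed by the integers, so that \<open>k - j\<close> in \<open>V_op\<close> may be negative.\<close>

definition ext_coeff :: "nat \<Rightarrow> complex poly \<Rightarrow> int \<Rightarrow> complex" where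
  "ext_coeff n p i = (if i \<in> {0..int n} then coeff p (nat i) else 0)"

text \<open>
  The operator \<open>V\<^sub>\<alpha>\<close> on polynomials of degree at most \<open>n\<close>. The series over \<open>j\<close> has only
  finitely many non-zero terms, as \<open>ext_coeff n p (k - j) = 0\<close> for \<open>j > k\<close>.
\<close>

definition V_op :: "(nat \<Rightarrow> real) \<Rightarrow> nat \<Rightarrow> complex poly \<Rightarrow> complex poly" where
  "V_op \<alpha> n p = (\<Sum>k=0..n. monom
     (\<Sum>j. complex_of_real (\<alpha> j) * ext_coeff n p (int k - int j) * ext_coeff n p (int k + 1 + int j)) k)"

end

theory Submission
  imports Defs "HOL-Computational_Algebra.Fundamental_Theorem_Algebra"
begin

text \<open>
  For \<open>p = \<Prod> (s + y\<^sub>i)\<close>, comparing coefficients in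
  \<open>p (x s) p (x / s) = \<Prod> (y\<^sub>i\<^sup>2 + x\<^sup>2 + x y\<^sub>i (s + 1 / s))\<close> gives
  \<open>x V\<^sub>\<alpha>(p)(x\<^sup>2) = M (\<Prod> (y\<^sub>i\<^sup>2 + x\<^sup>2 + x y\<^sub>i t))\<close> for a linear functional \<open>M\<close> on
  polynomials in \<open>t\<close> that depends only on \<open>\<alpha>\<close> and \<open>n\<close> and satisfies
  \<open>M ((1 + u t)\<^sup>n) = n! u Q(u\<^sup>2)\<close>, where \<open>Q\<close> is the polynomial of (iii). If \<open>Re x > 0\<close> and
  \<open>y\<^sub>i > 0\<close>, then the numbers \<open>u\<^sub>i = x y\<^sub>i / (y\<^sub>i\<^sup>2 + x\<^sup>2)\<close> have positive real parts. By the
  Grace-Walsh-Szego theorem \<open>M (\<Prod> (1 + u\<^sub>i t))\<close>, with \<open>d\<close> factors, can only vanish if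
  \<open>M ((1 + u t)\<^sup>d)\<close> vanishes for some \<open>u\<close> in the right half-plane. Laguerre's theorem reduces
  the case \<open>d < n\<close> to \<open>d = n\<close>, so (iii) implies (i). The choice
  \<open>p = (1 + s)\<^sup>n\<close>, with \<open>u = x / (1 + x\<^sup>2)\<close>, shows that (ii) implies (iii).
\<close>

section \<open>Linear functionals on polynomials in \<open>t\<close>\<close>

text \<open>A functional such as \<open>M\<close>, encoded by its values \<open>c q\<close> on the
  powers t^q; multiplying the argument by t shifts \<open>c\<close>.\<close>

definition appl :: "(nat \<Rightarrow> complex) \<Rightarrow> complex poly \<Rightarrow> complex" where
  "appl c h = (\<Sum>q\<le>degree h. coeff h q * c q)"

lemma appl_eq: "degree h \<le> N \<Longrightarrow> appl c h = (\<Sum>q\<le>N. coeff h q * c q)"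
  unfolding appl_def by (rule sum.mono_neutral_left) (auto simp: coeff_eq_0)

lemma appl_add: "appl c (g + h) = appl c g + appl c h"
proof -
  let ?N = "max (degree g) (degree h)"
  have "degree (g + h) \<le> ?N"
    by (rule degree_add_le_max)
  then show ?thesis
    by (simp add: appl_eq[of _ ?N] sum.distrib distrib_right)
qed

lemma appl_smult: "appl c (smult a h) = a * appl c h"
  by (simp add: appl_eq[of "smult a h" "degree h"] appl_def sum_distrib_left mult.assoc)

lemma appl_pCons: "appl c (pCons a h) = a * c 0 + appl (\<lambda>q. c (Suc q)) h"
  by (simp add: appl_eq[of "pCons a h" "Suc (degree h)"] sum.atMost_Suc_shift appl_def degree_pCons_le
      del: sum.atMost_Suc)

lemma appl_linear_mult:
  "appl c ([:a, b:] * h) = a * appl c h + b * appl (\<lambda>q. c (Suc q)) h"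
  by (simp add: appl_add appl_smult appl_pCons)

section \<open>Correlations of coefficients and powers of s + 1/s\<close>

definition int_coeff :: "complex poly \<Rightarrow> int \<Rightarrow> complex" where
  "int_coeff p i = (if i < 0 then 0 else coeff p (nat i))"

text \<open>The coefficient of s^m in the Laurent polynomial p(s) p(1/s).\<close>

definition corr :: "complex poly \<Rightarrow> int \<Rightarrow> complex" where
  "corr p m = (\<Sum>b\<le>degree p. coeff p b * int_coeff p (int b + m))"

lemma corr_eq:
  "degree p \<le> N \<Longrightarrow> corr p m = (\<Sum>b\<le>N. coeff p b * int_coeff p (int b + m))"
  unfolding corr_def by (rule sum.mono_neutral_left) (auto simp: coeff_eq_0)

lemma int_coeff_of_nat [simp]: "int_coeff p (int k) = coeff p k"
  by (simp add: int_coeff_def)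

lemma int_coeff_neg [simp]: "i < 0 \<Longrightarrow> int_coeff p i = 0"
  by (simp add: int_coeff_def)

lemma int_coeff_linear_mult:
  "int_coeff ([:y, x:] * p) i = y * int_coeff p i + x * int_coeff p (i - 1)"
  by (auto simp: int_coeff_def coeff_pCons nat_diff_distrib split: nat.splits)

text \<open>Multiplying \<open>p\<close> by y + x s multiplies p(s) p(1/s) by y^2 + x^2 + x y (s +
  1/s), and s and 1/s shift the index by one.\<close>

lemma corr_linear_mult:
  "corr ([:y, x:] * p) m = (y\<^sup>2 + x\<^sup>2) * corr p m + x * y * (corr p (m - 1) + corr p (m + 1))"
proof -
  let ?N = "degree p" and ?p = "int_coeff p"
  \<comment> \<open>The term \<open>b = 0\<close> contains the coefficient with index -1, which is
    0.\<close>
  have shift: "(\<Sum>b\<le>Suc ?N. ?p (int b - 1) * ?p (int b + k)) = corr p (k + 1)" for k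
    by (simp add: sum.atMost_Suc_shift corr_def add.commute add.left_commute del: sum.atMost_Suc)
  have stay: "(\<Sum>b\<le>Suc ?N. ?p (int b) * ?p (int b + k)) = corr p k" for k
    using corr_eq[of p "Suc ?N" k] by simp
  have "degree ([:y, x:] * p) \<le> Suc ?N"
    by (rule order_trans[OF degree_mult_le]) (simp add: degree_pCons_le)
  then have "corr ([:y, x:] * p) m = (\<Sum>b\<le>Suc ?N.
      int_coeff ([:y, x:] * p) (int b) * int_coeff ([:y, x:] * p) (int b + m))"
    by (simp only: corr_eq int_coeff_of_nat)
  also have "\<dots> = (\<Sum>b\<le>Suc ?N. y\<^sup>2 * (?p (int b) * ?p (int b + m))
      + x\<^sup>2 * (?p (int b - 1) * ?p (int b + (m - 1)))
      + x * y * (?p (int b) * ?p (int b + (m - 1)) + ?p (int b - 1) * ?p (int b + m)))"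
    by (intro sum.cong refl, simp only: int_coeff_linear_mult) (simp add: algebra_simps power2_eq_square)
  also have "\<dots> = y\<^sup>2 * corr p m + x\<^sup>2 * corr p m + x * y * (corr p (m - 1) + corr p (m + 1))"
    by (simp only: sum.distrib flip: sum_distrib_left) (simp only: shift stay, simp)
  finally show ?thesis
    by (simp add: algebra_simps)
qed

text \<open>The coefficient of \<open>s\<^sup>m\<close> in the Laurent polynomial \<open>(s + 1/s)\<^sup>q\<close>.\<close>

primrec walks :: "nat \<Rightarrow> int \<Rightarrow> nat" where
  "walks 0 m = (if m = 0 then 1 else 0)"
| "walks (Suc q) m = walks q (m - 1) + walks q (m + 1)"

lemma walks_eq_0: "int q < m \<Longrightarrow> walks q m = 0"
  by (induction q arbitrary: m) auto

lemma walks_eq_0_odd: "odd (int q + m) \<Longrightarrow> walks q m = 0"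
  by (induction q arbitrary: m) (auto simp: algebra_simps)

text \<open>Taking 1/s from \<open>b\<close> of the \<open>q\<close> factors s + 1/s gives the
  exponent q - 2b; the induction step is Pascal's rule.\<close>

lemma walks_binomial: "walks q (int q - 2 * int b) = q choose b"
proof (induction q arbitrary: b)
  case 0
  then show ?case by (cases b) auto
next
  case (Suc q)
  show ?case
  proof (cases b)
    case 0
    then show ?thesis using Suc[of 0] by (simp add: walks_eq_0)
  next
    case (Suc b')
    then show ?thesis using Suc.IH[of b] Suc.IH[of b'] by (simp add: algebra_simps)
  qed
qed

text \<open>
  Comparison of coefficients of \<open>s\<^sup>m\<close> in
  \<open>\<Prod> (y + x s) (y + x / s) = \<Prod> (y\<^sup>2 + x\<^sup>2 + x y (s + 1 / s))\<close>.
\<close>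

lemma corr_prod:
  "corr (\<Prod>y\<leftarrow>ys. [:y, x:]) m
     = appl (\<lambda>q. of_nat (walks q m)) (\<Prod>y\<leftarrow>ys. [:y\<^sup>2 + x\<^sup>2, x * y:])"
proof (induction ys arbitrary: m)
  case Nil
  then show ?case by (simp add: corr_def appl_def int_coeff_def)
next
  case (Cons y ys)
  have add: "appl (\<lambda>q. f q + g q) h = appl f h + appl g h" for f g h
    by (simp add: appl_def distrib_left sum.distrib)
  show ?case
    by (simp only: list.map prod_list.Cons corr_linear_mult appl_linear_mult Cons.IH walks.simps
        of_nat_add add)
qed

lemma corr_smult: "corr (smult a p) m = a\<^sup>2 * corr p m"
proof -
  have "int_coeff (smult a p) i = a * int_coeff p i" for i
    by (simp add: int_coeff_def)
  then show ?thesis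
    by (simp add: corr_eq[of "smult a p" "degree p"] corr_def sum_distrib_left power2_eq_square mult_ac)
qed

section \<open>The operator as a functional of products\<close>

lemma ext_coeff_eq: "degree p \<le> n \<Longrightarrow> ext_coeff n p i = int_coeff p i"
  by (auto simp: ext_coeff_def int_coeff_def coeff_eq_0)

text \<open>With b = k - j, the product of the coefficients k - j and k + 1 + j is a term of the
  correlation at distance 2j + 1. Substituting x s for s weights it by x^(2k+1), whence the
  prefactor \<open>x\<close> and the argument x^2.\<close>

lemma V_op_corr:
  assumes "degree p \<le> n"
  shows "x * poly (V_op \<alpha> n p) (x\<^sup>2)
    = (\<Sum>j\<le>n. of_real (\<alpha> j) * corr (pcompose p [:0, x:]) (2 * int j + 1))"
proof -
  let ?a = "coeff p" and ?e = "int_coeff p"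
  let ?T = "\<lambda>j k. of_real (\<alpha> j) * (?e (int k - int j) * ?e (int k + 1 + int j)) * x ^ (2 * k + 1)"
  have c: "(\<Sum>j. complex_of_real (\<alpha> j) * ext_coeff n p (int k - int j) * ext_coeff n p (int k + 1 + int j))
      = (\<Sum>j\<le>n. of_real (\<alpha> j) * (?e (int k - int j) * ?e (int k + 1 + int j)))" if "k \<le> n" for k
    using that by (subst suminf_finite[of "{..n}"]) (auto simp: ext_coeff_eq[OF assms] mult.assoc)
  have "poly (V_op \<alpha> n p) (x\<^sup>2)
    = (\<Sum>k\<le>n. (\<Sum>j\<le>n. of_real (\<alpha> j) * (?e (int k - int j) * ?e (int k + 1 + int j))) * x ^ (2 * k))"
    unfolding V_op_def poly_sum poly_monom atLeast0AtMost power_mult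
    by (intro sum.cong refl, subst c) auto
  then have "x * poly (V_op \<alpha> n p) (x\<^sup>2) = (\<Sum>k\<le>n. \<Sum>j\<le>n. ?T j k)"
    by (simp add: sum_distrib_left sum_distrib_right mult_ac)
  also have "\<dots> = (\<Sum>j\<le>n. \<Sum>k\<le>n. ?T j k)"
    by (rule sum.swap)
  also have "\<dots> = (\<Sum>j\<le>n. of_real (\<alpha> j) * corr (pcompose p [:0, x:]) (2 * int j + 1))"
  proof (rule sum.cong[OF refl])
    fix j assume "j \<in> {..n}"
    then have j: "j \<le> n" by simp
    have e: "int_coeff (pcompose p [:0, x:]) (int b + (2 * int j + 1)) = x ^ (b + 2 * j + 1) * ?a (b + 2 * j + 1)" for b
    proof -
      have "int b + (2 * int j + 1) = int (b + 2 * j + 1)" by simp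
      then show ?thesis by (simp only: int_coeff_of_nat coeff_pcompose_linear)
    qed
    have deg: "degree (pcompose p [:0, x:]) \<le> n"
      using assms by (simp add: degree_pcompose)
    have "of_real (\<alpha> j) * corr (pcompose p [:0, x:]) (2 * int j + 1)
      = (\<Sum>b\<le>n. of_real (\<alpha> j) * (?a b * ?a (b + 2 * j + 1)) * x ^ (2 * (b + j) + 1))"
      unfolding corr_eq[OF deg] e coeff_pcompose_linear sum_distrib_left
      by (simp add: mult_ac power_add mult_2 mult_2_right)
    \<comment> \<open>For b > n - j the index b + 2j + 1 exceeds the degree. After the cut, k = b +
      j runs exactly from j to n.\<close>
    also have "\<dots> = (\<Sum>b\<le>n-j. of_real (\<alpha> j) * (?a b * ?a (b + 2 * j + 1)) * x ^ (2 * (b + j) + 1))"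
      using assms by (intro sum.mono_neutral_right) (auto simp: coeff_eq_0)
    also have "\<dots> = (\<Sum>k=j..n. ?T j k)"
    proof (rule sum.reindex_bij_witness[of _ "\<lambda>k. k - j" "\<lambda>b. b + j"], goal_cases)
      case (5 b)
      have "int (b + j) + 1 + int j = int (b + 2 * j + 1)" "int (b + j) - int j = int b" by simp_all
      then show ?case by (simp only: int_coeff_of_nat)
    qed (use j in auto)
    also have "\<dots> = (\<Sum>k\<le>n. ?T j k)"
      by (intro sum.mono_neutral_left) auto
    finally show "(\<Sum>k\<le>n. ?T j k) = of_real (\<alpha> j) * corr (pcompose p [:0, x:]) (2 * int j + 1)" ..
  qed
  finally show ?thesis .
qed

text \<open>The value M(t^q): after t = s + 1/s, the coefficient of s^(2j+1) gets the weight
  \<open>\<alpha> j\<close>.\<close>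

definition walk_weight :: "(nat \<Rightarrow> real) \<Rightarrow> nat \<Rightarrow> nat \<Rightarrow> complex" where
  "walk_weight \<alpha> n q = (\<Sum>j\<le>n. of_real (\<alpha> j) * of_nat (walks q (2 * int j + 1)))"

lemma V_op_prod:
  assumes "length ys \<le> n"
  shows "x * poly (V_op \<alpha> n (smult a (\<Prod>y\<leftarrow>ys. [:y, 1:]))) (x\<^sup>2)
    = a\<^sup>2 * appl (walk_weight \<alpha> n) (\<Prod>y\<leftarrow>ys. [:y\<^sup>2 + x\<^sup>2, x * y:])"
proof -
  let ?h = "\<Prod>y\<leftarrow>ys. [:y\<^sup>2 + x\<^sup>2, x * y:]"
  have deg: "degree (\<Prod>y\<leftarrow>ys. [:y, 1:]) \<le> length ys"
    by (induction ys) (auto intro!: order_trans[OF degree_mult_le] simp del: mult_pCons_left)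
  have comp: "pcompose (\<Prod>y\<leftarrow>ys. [:y, 1:]) [:0, x:] = (\<Prod>y\<leftarrow>ys. [:y, x:])"
    by (induction ys) (auto simp: pcompose_mult pcompose_pCons one_pCons simp del: mult_pCons_left)
  have "x * poly (V_op \<alpha> n (smult a (\<Prod>y\<leftarrow>ys. [:y, 1:]))) (x\<^sup>2)
    = (\<Sum>j\<le>n. of_real (\<alpha> j) * (a\<^sup>2 * appl (\<lambda>q. of_nat (walks q (2 * int j + 1))) ?h))"
    using assms by (subst V_op_corr)
      (simp_all add: order_trans[OF degree_smult_le] order_trans[OF deg]
         pcompose_smult comp corr_smult corr_prod)
  also have "\<dots> = a\<^sup>2 * (\<Sum>j\<le>n. \<Sum>q\<le>degree ?h. coeff ?h q * (of_real (\<alpha> j) * of_nat (walks q (2 * int j + 1))))"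
    by (simp add: appl_def sum_distrib_left mult_ac)
  also have "\<dots> = a\<^sup>2 * appl (walk_weight \<alpha> n) ?h"
    by (subst sum.swap) (simp add: appl_def walk_weight_def sum_distrib_left)
  finally show ?thesis .
qed

lemma walk_weight_even: "even q \<Longrightarrow> walk_weight \<alpha> n q = 0"
  by (simp add: walk_weight_def walks_eq_0_odd)

text \<open>The binomial coefficient (2r+1 choose r-j) is (2r+1)! / ((r+1+j)! (r-j)!), the source of
  the inner sum in (iii). As r \<le> n, the cutoff at \<open>n\<close> loses no nonzero
  term.\<close>

lemma walk_weight_odd:
  assumes "r \<le> n"
  shows "walk_weight \<alpha> n (2 * r + 1)
    = fact (2 * r + 1) * of_real (\<Sum>j=0..r. \<alpha> j / (fact (r + 1 + j) * fact (r - j)))"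
proof -
  have "walk_weight \<alpha> n (2 * r + 1) = (\<Sum>j\<le>r. of_real (\<alpha> j) * of_nat (walks (2 * r + 1) (2 * int j + 1)))"
    unfolding walk_weight_def using assms
    by (intro sum.mono_neutral_right) (auto simp: walks_eq_0 simp del: walks.simps)
  also have "\<dots> = (\<Sum>j\<le>r. fact (2 * r + 1) * of_real (\<alpha> j / (fact (r + 1 + j) * fact (r - j))))"
  proof (intro sum.cong refl)
    fix j assume "j \<in> {..r}"
    then have j: "j \<le> r" by simp
    have "2 * int j + 1 = int (2 * r + 1) - 2 * int (r - j)" using j by simp
    then have "walks (2 * r + 1) (2 * int j + 1) = (2 * r + 1) choose (r - j)"
      using walks_binomial by metis
    moreover have "2 * r + 1 - (r - j) = r + 1 + j" using j by simp
    ultimately show "of_real (\<alpha> j) * of_nat (walks (2 * r + 1) (2 * int j + 1))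
      = fact (2 * r + 1) * complex_of_real (\<alpha> j / (fact (r + 1 + j) * fact (r - j)))"
      using j by (simp add: binomial_fact field_simps del: fact_Suc walks.simps)
  qed
  finally show ?thesis
    by (simp add: sum_distrib_left atLeast0AtMost del: fact_Suc)
qed

section \<open>Laguerre's theorem\<close>

lemma poly_factor_list:
  fixes f :: "complex poly"
  assumes "f \<noteq> 0"
  obtains xs where "length xs = degree f" "f = smult (lead_coeff f) (\<Prod>x\<leftarrow>xs. [:- x, 1:])"
proof -
  obtain A where A: "size A = degree f" "f = smult (lead_coeff f) (\<Prod>x\<in>#A. [:- x, 1:])"
    using alg_closed_imp_factorization[OF assms] by blast
  obtain xs where "mset xs = A"
    using ex_mset by blast
  then have "length xs = degree f" "f = smult (lead_coeff f) (\<Prod>x\<leftarrow>xs. [:- x, 1:])"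
    using A by (metis size_mset, metis mset_map prod_mset_prod_list)
  then show ?thesis
    using that by blast
qed

lemma poly_linear_prod_eq_0_iff:
  "poly (\<Prod>x\<leftarrow>xs. [:- x, 1:]) w = 0 \<longleftrightarrow> (w :: complex) \<in> set xs"
  by (induction xs) (auto simp del: mult_pCons_left)

lemma pderiv_linear_prod:
  assumes "(w :: complex) \<notin> set xs"
  shows "poly (pderiv (\<Prod>x\<leftarrow>xs. [:- x, 1:])) w
    = poly (\<Prod>x\<leftarrow>xs. [:- x, 1:]) w * (\<Sum>x\<leftarrow>xs. 1 / (w - x))"
  using assms
  by (induction xs) (auto simp: pderiv_mult pderiv_pCons field_simps simp del: mult_pCons_left)

text \<open>
  Laguerre's theorem on polar derivatives, for the closed right half-plane. The numbers
  \<open>1 / (w - x)\<close>, with \<open>x\<close> a zero of \<open>f\<close>, lie in a disc whose interior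
  omits \<open>1 / (w - u)\<close>, and a sum of squared distances shows that they can only average to this
  number if all of them are equal to it, that is, if \<open>f\<close> is a multiple of
  \<open>(z - u) ^ n\<close>, for which the polar derivative vanishes identically.
\<close>

lemma laguerre:
  assumes nz: "\<And>w. Re w > 0 \<Longrightarrow> poly f w \<noteq> 0" and n: "degree f \<le> n" "n > 0"
    and u: "Re u \<ge> 0" and w: "Re w > 0"
    and eq: "of_nat n * poly f w + (u - w) * poly (pderiv f) w = 0"
  shows "of_nat n * poly f v + (u - v) * poly (pderiv f) v = 0"
proof -
  have "f \<noteq> 0"
    using nz[OF w] by auto
  then obtain xs where len: "length xs = degree f" and f: "f = smult (lead_coeff f) (\<Prod>x\<leftarrow>xs. [:- x, 1:])"
    by (rule poly_factor_list)
  have f': "poly f w = lead_coeff f * poly (\<Prod>x\<leftarrow>xs. [:- x, 1:]) w"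
    "pderiv f = smult (lead_coeff f) (pderiv (\<Prod>x\<leftarrow>xs. [:- x, 1:]))" for w
    by (subst f, simp) (subst f, simp add: pderiv_smult)
  have re: "Re x \<le> 0" if "x \<in> set xs" for x
    using nz[of x] that poly_linear_prod_eq_0_iff[of xs x] f'(1)[of x] by force
  have wn: "w \<notin> set xs"
    using re w by force
  \<comment> \<open>The logarithmic derivative of \<open>f\<close> at \<open>w\<close>; the
    vanishing polar derivative says S = n / (w - u).\<close>
  define S where "S = (\<Sum>x\<leftarrow>xs. 1 / (w - x))"
  have "poly (pderiv f) w = poly f w * S"
    by (simp add: f' pderiv_linear_prod[OF wn] S_def)
  then have "poly f w * (of_nat n + (u - w) * S) = 0"
    using eq by (simp add: algebra_simps)
  then have "of_nat n + (u - w) * S = 0"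
    using nz[OF w] by simp
  then have "of_nat n = - ((u - w) * S)"
    by (simp only: eq_neg_iff_add_eq_0)
  then have nS: "of_nat n = (w - u) * S"
    by (simp add: algebra_simps)
  then have wu: "w \<noteq> u"
    using n by auto
  define q0 where "q0 = 1 / (w - u)"
  have S: "S = of_nat n * q0"
    using nS wu by (simp add: q0_def field_simps)
  define a where "a = Re w"
  have a: "a > 0" using w by (simp add: a_def)
  \<comment> \<open>By this identity the points q = 1/(w - x) lie in the disc |q|^2 \<le> Re q / a,
    since Re (w - x) \<ge> a, while Re (w - u) \<le> a gives the reverse inequality for
    \<open>q0\<close>.\<close>
  have inv: "Re (1 / z) = Re z * (cmod (1 / z))\<^sup>2" for z
    by (simp add: Re_divide norm_divide power_divide cmod_power2)
  have q0: "Re q0 / a \<le> (cmod q0)\<^sup>2"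
    using a u unfolding q0_def by (subst inv) (simp add: a_def pos_divide_le_eq mult.commute[of _ "Re w"] mult_right_mono)
  have q: "(cmod (1 / (w - x)))\<^sup>2 \<le> Re (1 / (w - x)) / a" if "x \<in> set xs" for x
  proof -
    have "a * (cmod (1 / (w - x)))\<^sup>2 \<le> Re (w - x) * (cmod (1 / (w - x)))\<^sup>2"
      using re[OF that] by (intro mult_right_mono) (auto simp: a_def)
    then show ?thesis
      using a by (subst inv) (simp add: pos_le_divide_eq mult.commute)
  qed
  have dist: "(cmod (p - q0))\<^sup>2 = (cmod p)\<^sup>2 + (cmod q0)\<^sup>2 - 2 * Re (cnj q0 * p)" for p
    unfolding cmod_power2 by (simp add: power2_eq_square algebra_simps)
  \<comment> \<open>Each squared distance is expanded by \<open>dist\<close>, and |q|^2 is replaced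
    by its bound Re q / a.\<close>
  have "(\<Sum>x\<leftarrow>xs. (cmod (1 / (w - x) - q0))\<^sup>2)
    \<le> Re S / a + length xs * (cmod q0)\<^sup>2 - 2 * Re (cnj q0 * S)"
    unfolding S_def using q
  proof (induction xs)
    case (Cons x xs)
    have "(cmod (1 / (w - x) - q0))\<^sup>2
      \<le> Re (1 / (w - x)) / a + (cmod q0)\<^sup>2 - 2 * Re (cnj q0 * (1 / (w - x)))"
      unfolding dist using Cons.prems[of x] by simp
    moreover have "(\<Sum>x\<leftarrow>xs. (cmod (1 / (w - x) - q0))\<^sup>2)
      \<le> Re (\<Sum>x\<leftarrow>xs. 1 / (w - x)) / a + length xs * (cmod q0)\<^sup>2 - 2 * Re (cnj q0 * (\<Sum>x\<leftarrow>xs. 1 / (w - x)))"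
      using Cons by simp
    ultimately show ?case
      by (simp only: list.map sum_list.Cons list.size of_nat_add plus_complex.sel distrib_left
          add_divide_distrib) (simp add: algebra_simps)
  qed simp
  also have "\<dots> = n * (Re q0 / a) + degree f * (cmod q0)\<^sup>2 - 2 * n * (cmod q0)\<^sup>2"
    unfolding S len cmod_power2 by (simp add: power2_eq_square algebra_simps)
  also have "\<dots> \<le> n * (cmod q0)\<^sup>2 + degree f * (cmod q0)\<^sup>2 - 2 * n * (cmod q0)\<^sup>2"
    using mult_left_mono[OF q0, of "real n"] by simp
  also have "\<dots> = - ((real n - degree f) * (cmod q0)\<^sup>2)"
    by (simp add: algebra_simps)
  finally have le: "(\<Sum>x\<leftarrow>xs. (cmod (1 / (w - x) - q0))\<^sup>2) \<le> - ((real n - degree f) * (cmod q0)\<^sup>2)" .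
  have ge: "0 \<le> (\<Sum>x\<leftarrow>xs. (cmod (1 / (w - x) - q0))\<^sup>2)"
    by (intro sum_list_nonneg) auto
  have "(cmod q0)\<^sup>2 > 0"
    using wu by (simp add: q0_def)
  \<comment> \<open>A degree below \<open>n\<close> would make the upper bound negative. In degree
    \<open>n\<close> all distances are 0, so every zero of \<open>f\<close> is
    \<open>u\<close>.\<close>
  then have deg: "degree f = n"
    using le ge n by (smt (verit) mult_pos_pos of_nat_less_iff order_le_imp_less_or_eq)
  then have "(\<Sum>x\<leftarrow>xs. (cmod (1 / (w - x) - q0))\<^sup>2) = 0"
    using le ge by simp
  then have "1 / (w - x) = q0" if "x \<in> set xs" for x
    using that by (subst (asm) sum_list_nonneg_eq_0_iff) auto
  then have "x = u" if "x \<in> set xs" for x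
    using that wu wn unfolding q0_def by (metis divide_cancel_left diff_eq_diff_eq diff_left_imp_eq one_neq_zero)
  then have "xs = replicate n u"
    using len deg by (metis replicate_length_same)
  then have "f = smult (lead_coeff f) ([:- u, 1:] ^ n)"
    using f by (simp add: map_replicate)
  then obtain c where c: "f = smult c ([:- u, 1:] ^ n)" ..
  obtain d where d: "n = Suc d"
    using n by (cases n) auto
  show ?thesis
    \<comment> \<open>Up to a constant factor this is n (v - u)^n + (u - v) n (v - u)^(n-1) =
      0.\<close>
    unfolding c d pderiv_smult pderiv_power_Suc by (simp add: pderiv_pCons algebra_simps)
qed

section \<open>The Grace-Walsh-Szego theorem\<close>

text \<open>The functional's value at (1 + w t)^n as a polynomial in \<open>w\<close>, the form in
  which Laguerre's theorem is applied.\<close>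

definition appl_poly :: "(nat \<Rightarrow> complex) \<Rightarrow> nat \<Rightarrow> complex poly" where
  "appl_poly c n = (\<Sum>k\<le>n. monom (of_nat (n choose k) * c k) k)"

lemma coeff_appl_poly: "coeff (appl_poly c n) k = of_nat (n choose k) * c k"
  by (cases "k \<le> n") (auto simp: appl_poly_def coeff_sum binomial_eq_0_iff)

lemma coeff_linear_power_choose: "coeff ([:1, w:] ^ n) k = of_nat (n choose k) * (w :: complex) ^ k"
  using coeff_linear_poly_power[of k n 1 w]
  by (cases "k \<le> n") (auto simp: coeff_eq_0 degree_linear_power binomial_eq_0 intro!: coeff_eq_0 le_less_trans[OF degree_power_le])

lemma poly_appl_poly: "poly (appl_poly c n) w = appl c ([:1, w:] ^ n)"
proof -
  have "degree ([:1, w:] ^ n) \<le> n"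
    by (rule order_trans[OF degree_power_le]) (simp add: degree_pCons_le)
  then show ?thesis
    by (simp add: appl_eq appl_poly_def poly_sum poly_monom coeff_linear_power_choose mult_ac)
qed

lemma degree_appl_poly: "degree (appl_poly c n) \<le> n"
  unfolding appl_poly_def by (intro degree_sum_le) (auto intro: order_trans[OF degree_monom_le])

lemma pderiv_appl_poly:
  "pderiv (appl_poly c (Suc d)) = smult (of_nat (Suc d)) (appl_poly (\<lambda>k. c (Suc k)) d)"
proof -
  have eq: "of_nat (Suc k) * (of_nat (Suc d choose Suc k) * c (Suc k))
      = of_nat (Suc d) * (of_nat (d choose k) * c (Suc k))" for k
    using Suc_times_binomial[of k d] by (metis (no_types) mult.assoc of_nat_mult)
  show ?thesis
    by (rule poly_eqI) (simp only: coeff_pderiv coeff_appl_poly coeff_smult eq)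
qed

text \<open>Since 1 + u t = (1 + w t) + (u - w) t, exchanging one of the d + 1 equal factors for 1 +
  u t produces the polar derivative.\<close>

lemma appl_polar:
  "of_nat (Suc d) * appl c ([:1, u:] * [:1, w:] ^ d)
    = of_nat (Suc d) * poly (appl_poly c (Suc d)) w + (u - w) * poly (pderiv (appl_poly c (Suc d))) w"
  by (simp add: pderiv_appl_poly poly_appl_poly appl_linear_mult algebra_simps del: mult_pCons_left)

text \<open>
  The second alternative cannot be dropped: passing from \<open>n\<close> to \<open>n - 1\<close> may turn a
  functional of the first kind into one of the second kind.
\<close>

definition stable_or_zero :: "(nat \<Rightarrow> complex) \<Rightarrow> nat \<Rightarrow> bool" where
  "stable_or_zero c n \<longleftrightarrow>
     (\<forall>w. Re w > 0 \<longrightarrow> appl c ([:1, w:] ^ n) \<noteq> 0) \<or> (\<forall>w. appl c ([:1, w:] ^ n) = 0)"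

lemma appl_polarize: "appl (\<lambda>q. c q + u * c (Suc q)) h = appl c ([:1, u:] * h)"
  by (simp only: appl_linear_mult) (simp add: appl_def distrib_left sum.distrib sum_distrib_left mult_ac)

lemma appl_zero:
  assumes "\<And>w. appl c ([:1, w:] ^ n) = 0" "degree h \<le> n"
  shows "appl c h = 0"
proof -
  have "appl_poly c n = 0"
    using assms(1) by (simp add: poly_appl_poly flip: poly_all_0_iff_0)
  then have "c k = 0" if "k \<le> n" for k
    using coeff_appl_poly[of c n k] that by simp
  then show ?thesis
    using assms(2) by (auto simp: appl_def intro!: sum.neutral)
qed

text \<open>By Laguerre's theorem a single zero of the polar derivative in the open right half-plane
  forces it to vanish identically. The boundary case u = 0 keeps \<open>c\<close> and only lowers
  the degree.\<close>

lemma stable_or_zero_polar: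
  assumes "stable_or_zero c (Suc d)" "Re u \<ge> 0"
  shows "stable_or_zero (\<lambda>q. c q + u * c (Suc q)) d"
proof -
  consider "\<And>w. Re w > 0 \<Longrightarrow> poly (appl_poly c (Suc d)) w \<noteq> 0" | "\<And>w. appl c ([:1, w:] ^ Suc d) = 0"
    using assms(1) unfolding stable_or_zero_def poly_appl_poly by blast
  then show ?thesis
  proof cases
    case 1
    have "appl c ([:1, u:] * [:1, v:] ^ d) = 0"
      if "Re w > 0" "appl c ([:1, u:] * [:1, w:] ^ d) = 0" for v w
      using laguerre[OF 1 degree_appl_poly _ assms(2) that(1), of v] that(2)
      by (simp flip: appl_polar del: mult_pCons_left of_nat_Suc)
    then show ?thesis
      unfolding stable_or_zero_def appl_polarize by blast
  next
    case 2
    have "degree ([:1, u:] * [:1, w:] ^ d) \<le> Suc d" for w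
      by (intro order_trans[OF degree_mult_le] order_trans[OF add_mono[OF _ degree_power_le]])
        (auto simp: degree_pCons_le)
    then show ?thesis
      unfolding stable_or_zero_def appl_polarize using appl_zero[OF 2] by blast
  qed
qed

lemma stable_or_zero_mono:
  assumes "stable_or_zero c n" "d \<le> n"
  shows "stable_or_zero c d"
  using assms(2,1) by (induction rule: inc_induct) (use stable_or_zero_polar[of _ _ 0] in auto)

lemma grace_walsh_szego:
  assumes "\<And>w. Re w > 0 \<Longrightarrow> appl c ([:1, w:] ^ length us) \<noteq> 0" "\<And>u. u \<in> set us \<Longrightarrow> Re u > 0"
  shows "appl c (\<Prod>u\<leftarrow>us. [:1, u:]) \<noteq> 0"
  using assms
proof (induction us arbitrary: c)
  case Nil
  then show ?case using Nil(1)[of 1] by simp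
next
  case (Cons u us)
  let ?c = "\<lambda>q. c q + u * c (Suc q)"
  have "stable_or_zero c (Suc (length us))"
    using Cons.prems by (simp add: stable_or_zero_def)
  then have "stable_or_zero ?c (length us)"
    using Cons.prems(2)[of u] by (intro stable_or_zero_polar) auto
  \<comment> \<open>Evaluation at w = u restores the full power (1 + u t)^(d+1), with d the length
    of \<open>us\<close>, and so excludes the zero alternative.\<close>
  moreover have "appl ?c ([:1, u:] ^ length us) \<noteq> 0"
    unfolding appl_polarize using Cons.prems(1)[of u] Cons.prems(2)[of u] by simp
  ultimately have "\<And>w. Re w > 0 \<Longrightarrow> appl ?c ([:1, w:] ^ length us) \<noteq> 0"
    unfolding stable_or_zero_def by blast
  then have "appl ?c (\<Prod>u\<leftarrow>us. [:1, u:]) \<noteq> 0"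
    using Cons.prems(2) by (intro Cons.IH) auto
  then show ?case
    by (simp add: appl_polarize del: mult_pCons_left)
qed

section \<open>The polynomial of condition (iii)\<close>

definition kernel_poly :: "(nat \<Rightarrow> real) \<Rightarrow> nat \<Rightarrow> complex poly" where
  "kernel_poly \<alpha> n = (\<Sum>k | 2 * k + 1 \<le> n. monom (complex_of_real
     ((\<Sum>j=0..k. \<alpha> j / (fact (k + 1 + j) * fact (k - j))) / fact (n - 2 * k - 1))) k)"

text \<open>Only odd q = 2k + 1 contribute, and (n choose q) q! = n! / (n - q)! supplies the outer
  factorial.\<close>

lemma appl_walk_weight:
  "appl (walk_weight \<alpha> n) ([:1, u:] ^ n) = fact n * u * poly (kernel_poly \<alpha> n) (u\<^sup>2)"
proof -
  let ?g = "\<lambda>k. \<Sum>j=0..k. \<alpha> j / (fact (k + 1 + j) * fact (k - j))"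
  have "degree ([:1, u:] ^ n) \<le> n"
    by (rule order_trans[OF degree_power_le]) (simp add: degree_pCons_le)
  then have "appl (walk_weight \<alpha> n) ([:1, u:] ^ n)
    = (\<Sum>q\<le>n. of_nat (n choose q) * u ^ q * walk_weight \<alpha> n q)"
    by (simp add: appl_eq coeff_linear_power_choose)
  also have "\<dots> = (\<Sum>q | q \<le> n \<and> odd q. of_nat (n choose q) * u ^ q * walk_weight \<alpha> n q)"
    by (intro sum.mono_neutral_right) (auto simp: walk_weight_even)
  also have "\<dots> = (\<Sum>k | 2 * k + 1 \<le> n.
      of_nat (n choose (2 * k + 1)) * u ^ (2 * k + 1) * walk_weight \<alpha> n (2 * k + 1))"
    by (rule sum.reindex_bij_witness[of _ "\<lambda>k. 2 * k + 1" "\<lambda>q. q div 2"]) (auto elim!: oddE)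
  also have "\<dots> = (\<Sum>k | 2 * k + 1 \<le> n. fact n * u * (of_real (?g k / fact (n - 2 * k - 1)) * (u\<^sup>2) ^ k))"
  proof (intro sum.cong refl)
    fix k assume "k \<in> {k. 2 * k + 1 \<le> n}"
    then have k: "2 * k + 1 \<le> n" by simp
    have fact: "complex_of_nat (n choose (2 * k + 1)) * fact (2 * k + 1) = fact n / fact (n - 2 * k - 1)"
      using k by (simp add: binomial_fact del: fact_Suc)
    have u: "u ^ (2 * k + 1) = u * (u\<^sup>2) ^ k"
      by (simp add: power_mult)
    have weight: "walk_weight \<alpha> n (2 * k + 1) = fact (2 * k + 1) * of_real (?g k)"
      using k by (intro walk_weight_odd) simp
    have "of_nat (n choose (2 * k + 1)) * u ^ (2 * k + 1) * walk_weight \<alpha> n (2 * k + 1)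
      = (of_nat (n choose (2 * k + 1)) * fact (2 * k + 1)) * (u * (of_real (?g k) * (u\<^sup>2) ^ k))"
      unfolding u weight by (simp only: mult_ac)
    also have "\<dots> = fact n * u * (of_real (?g k / fact (n - 2 * k - 1)) * (u\<^sup>2) ^ k)"
      unfolding fact by simp
    finally show "of_nat (n choose (2 * k + 1)) * u ^ (2 * k + 1) * walk_weight \<alpha> n (2 * k + 1)
      = fact n * u * (of_real (?g k / fact (n - 2 * k - 1)) * (u\<^sup>2) ^ k)" .
  qed
  also have "\<dots> = fact n * u * poly (kernel_poly \<alpha> n) (u\<^sup>2)"
    by (simp add: kernel_poly_def poly_sum poly_monom sum_distrib_left)
  finally show ?thesis .
qed

lemma degree_kernel_poly: "degree (kernel_poly \<alpha> n) \<le> n"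
  unfolding kernel_poly_def
  by (intro degree_sum_le) (auto intro: order_trans[OF degree_monom_le] finite_subset[of _ "{..n}"])

lemma degree_V_op: "degree (V_op \<alpha> n p) \<le> n"
  unfolding V_op_def by (intro degree_sum_le) (auto intro: order_trans[OF degree_monom_le])

section \<open>Zeros and squares of the right half-plane\<close>

lemma Re_pos_power2: "Re x > 0 \<Longrightarrow> \<not> (x\<^sup>2 \<in> \<real> \<and> Re (x\<^sup>2) \<le> 0)"
  by (auto simp: complex_is_Real_iff Re_power2 Im_power2 not_le)

lemma square_root_Re_pos:
  assumes "\<not> (z \<in> \<real> \<and> Re z \<le> 0)"
  obtains x where "Re x > 0" "x\<^sup>2 = z"
proof -
  have "Re (csqrt z) \<noteq> 0"
  proof
    assume "Re (csqrt z) = 0"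
    then have "(csqrt z)\<^sup>2 \<in> \<real> \<and> Re ((csqrt z)\<^sup>2) \<le> 0"
      by (simp only: complex_is_Real_iff Re_power2 Im_power2) simp
    then show False
      using assms by simp
  qed
  then have "Re (csqrt z) > 0"
    using csqrt_principal[of z] by blast
  then show ?thesis
    using that[of "csqrt z"] by simp
qed

text \<open>Squaring maps the open right half-plane onto the complement of the non-positive reals.
  The second alternative gives infinitely many zeros, hence f = 0.\<close>

lemma in_P_plus_or_zero_iff:
  assumes "degree f \<le> n"
  shows "f \<in> P_plus n \<union> {0} \<longleftrightarrow>
    (\<forall>x. Re x > 0 \<longrightarrow> poly f (x\<^sup>2) \<noteq> 0) \<or> (\<forall>x. Re x > 0 \<longrightarrow> poly f (x\<^sup>2) = 0)"
    (is "_ \<longleftrightarrow> ?nz \<or> ?z")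
proof
  assume "f \<in> P_plus n \<union> {0}"
  then show "?nz \<or> ?z"
    using Re_pos_power2 by (auto simp: P_plus_def)
next
  assume "?nz \<or> ?z"
  then show "f \<in> P_plus n \<union> {0}"
  proof
    assume nz: ?nz
    then have "poly f (1\<^sup>2) \<noteq> 0"
      by (metis one_complex.sel(1) zero_less_one)
    then have "f \<noteq> 0"
      by auto
    moreover have "z \<in> \<real> \<and> Re z \<le> 0" if "poly f z = 0" for z
      using nz that square_root_Re_pos[of z] by metis
    ultimately show ?thesis
      using assms by (simp add: P_plus_def)
  next
    assume z: ?z
    have "f = 0"
    proof (rule ccontr)
      assume "f \<noteq> 0"
      then have "finite {z. poly f z = 0}"
        by (rule poly_roots_finite)
      moreover have "range (\<lambda>k::nat. (complex_of_nat (Suc k))\<^sup>2) \<subseteq> {z. poly f z = 0}"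
        using z by (auto simp del: of_nat_Suc)
      moreover have "inj (\<lambda>k::nat. (complex_of_nat (Suc k))\<^sup>2)"
        by (rule injI) (metis of_nat_power of_nat_eq_iff power2_eq_iff_nonneg zero_le nat.inject)
      ultimately show False
        using finite_imageD finite_subset infinite_UNIV_nat by blast
    qed
    then show ?thesis by simp
  qed
qed

section \<open>From (iii) to (i)\<close>

lemma kernel_poly_stable:
  assumes "kernel_poly \<alpha> n \<in> P_plus n \<union> {0}"
  shows "stable_or_zero (walk_weight \<alpha> n) n"
proof (cases "kernel_poly \<alpha> n = 0")
  case True
  then show ?thesis
    by (simp add: stable_or_zero_def appl_walk_weight)
next
  case False
  then have "poly (kernel_poly \<alpha> n) (w\<^sup>2) \<noteq> 0" if "Re w > 0" for w
    using assms Re_pos_power2[OF that] by (auto simp: P_plus_def)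
  then show ?thesis
    by (auto simp: stable_or_zero_def appl_walk_weight)
qed

text \<open>A factor with y = 0 is the constant x^2 and goes into \<open>b\<close>. For y > 0 the
  factor is x y D (1 + t/D) with D = y/x + x/y, and Re D > 0 because Re x > 0.\<close>

lemma symmetric_product_factorization:
  assumes "Re x > 0" "\<And>y. y \<in> set ys \<Longrightarrow> y \<in> \<real> \<and> Re y \<ge> 0"
  shows "\<exists>b us. b \<noteq> 0 \<and> length us = length (filter (\<lambda>y. y \<noteq> 0) ys) \<and> (\<forall>u\<in>set us. Re u > 0)
    \<and> (\<Prod>y\<leftarrow>ys. [:y\<^sup>2 + x\<^sup>2, x * y:]) = smult b (\<Prod>u\<leftarrow>us. [:1, u:])"
  using assms(2)
proof (induction ys)
  case Nil
  show ?case by (rule exI[of _ 1], rule exI[of _ "[]"]) simp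
next
  case (Cons y ys)
  then obtain b us where IH: "b \<noteq> 0" "length us = length (filter (\<lambda>y. y \<noteq> 0) ys)" "\<forall>u\<in>set us. Re u > 0"
    "(\<Prod>y\<leftarrow>ys. [:y\<^sup>2 + x\<^sup>2, x * y:]) = smult b (\<Prod>u\<leftarrow>us. [:1, u:])"
    by auto
  have x: "x \<noteq> 0" using assms(1) by auto
  show ?case
  proof (cases "y = 0")
    case True
    then show ?thesis
      using IH x by (intro exI[of _ "x\<^sup>2 * b"] exI[of _ us]) (simp add: mult.commute)
  next
    case False
    obtain r where r: "y = of_real r" "r > 0"
      using Cons.prems[of y] False by (auto elim!: Reals_cases simp: less_le)
    define D where "D = y / x + x / y"
    have "Re (y / x) > 0" "Re (x / y) > 0"
      using assms(1) r x by (simp_all add: Re_divide sum_power2_gt_zero_iff complex_eq_iff)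
    then have D: "Re D > 0"
      by (simp add: D_def)
    then have D0: "D \<noteq> 0" by auto
    have "Re (1 / D) > 0"
      using D D0 by (simp add: Re_divide sum_power2_gt_zero_iff complex_eq_iff)
    moreover have eq: "y\<^sup>2 + x\<^sup>2 = x * y * D"
      using x False by (simp add: D_def field_simps power2_eq_square)
    have "[:y\<^sup>2 + x\<^sup>2, x * y:] = smult (x * y * D) [:1, 1 / D:]"
      unfolding eq using D0 by simp
    ultimately show ?thesis
      using IH x False D0
      by (intro exI[of _ "x * y * D * b"] exI[of _ "1 / D # us"]) (simp add: mult_ac del: mult_pCons_left smult_pCons)
  qed
qed

lemma V_op_P_plus:
  assumes stable: "stable_or_zero (walk_weight \<alpha> n) n" and p: "p \<in> P_plus n"
  shows "V_op \<alpha> n p \<in> P_plus n \<union> {0}"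
proof -
  have p': "p \<noteq> 0" "degree p \<le> n" "\<And>z. poly p z = 0 \<Longrightarrow> z \<in> \<real> \<and> Re z \<le> 0"
    using p by (auto simp: P_plus_def)
  obtain xs where len: "length xs = degree p" and f: "p = smult (lead_coeff p) (\<Prod>x\<leftarrow>xs. [:- x, 1:])"
    using poly_factor_list[OF p'(1)] .
  define c where "c = lead_coeff p"
  define ys where "ys = map uminus xs"
  have c: "c \<noteq> 0" using p' by (simp add: c_def)
  have f: "p = smult c (\<Prod>y\<leftarrow>ys. [:y, 1:])"
    using f by (simp add: c_def ys_def o_def)
  have ys: "length ys \<le> n" "\<And>y. y \<in> set ys \<Longrightarrow> y \<in> \<real> \<and> Re y \<ge> 0"
  proof -
    show "length ys \<le> n" using len p' by (simp add: ys_def)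
    fix y assume "y \<in> set ys"
    then obtain x where x: "y = - x" "x \<in> set xs"
      by (auto simp: ys_def)
    then have "poly p x = 0"
      using poly_linear_prod_eq_0_iff[of xs x] by (simp add: f ys_def o_def)
    then show "y \<in> \<real> \<and> Re y \<ge> 0"
      using p'(3)[of x] x by auto
  qed
  let ?w = "walk_weight \<alpha> n"
  let ?d = "length (filter (\<lambda>y. y \<noteq> 0) ys)"
  have d: "?d \<le> n"
    using ys(1) length_filter_le order_trans by blast
  have red: "\<exists>us. length us = ?d \<and> (\<forall>u\<in>set us. Re u > 0)
      \<and> (poly (V_op \<alpha> n p) (x\<^sup>2) = 0 \<longleftrightarrow> appl ?w (\<Prod>u\<leftarrow>us. [:1, u:]) = 0)"
    if x: "Re x > 0" for x
  proof -
    obtain b us where us: "b \<noteq> 0" "length us = ?d" "\<forall>u\<in>set us. Re u > 0"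
      "(\<Prod>y\<leftarrow>ys. [:y\<^sup>2 + x\<^sup>2, x * y:]) = smult b (\<Prod>u\<leftarrow>us. [:1, u:])"
      using symmetric_product_factorization[OF x ys(2)] by blast
    have "x * poly (V_op \<alpha> n p) (x\<^sup>2) = c\<^sup>2 * (b * appl ?w (\<Prod>u\<leftarrow>us. [:1, u:]))"
      unfolding f V_op_prod[OF ys(1)] us(4) appl_smult ..
    moreover have "x \<noteq> 0" using x by auto
    ultimately have "poly (V_op \<alpha> n p) (x\<^sup>2) = 0 \<longleftrightarrow> appl ?w (\<Prod>u\<leftarrow>us. [:1, u:]) = 0"
      using c us(1) by (metis mult_eq_0_iff power_eq_0_iff)
    then show ?thesis
      using us by blast
  qed
  \<comment> \<open>The number of nonzero \<open>y\<close> can be smaller than \<open>n\<close>,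
    through the degree of \<open>p\<close> or a zero at 0, so stability is first lowered to that
    number.\<close>
  consider "\<And>w. Re w > 0 \<Longrightarrow> appl ?w ([:1, w:] ^ ?d) \<noteq> 0" | "\<And>w. appl ?w ([:1, w:] ^ ?d) = 0"
    using stable_or_zero_mono[OF stable d] unfolding stable_or_zero_def by blast
  then show ?thesis
  proof cases
    case 1
    then have "appl ?w (\<Prod>u\<leftarrow>us. [:1, u:]) \<noteq> 0" if "length us = ?d" "\<forall>u\<in>set us. Re u > 0" for us
      using that by (intro grace_walsh_szego) auto
    then show ?thesis
      using red by (subst in_P_plus_or_zero_iff[OF degree_V_op]) blast
  next
    case 2
    have "degree (\<Prod>u\<leftarrow>us. [:1, u:]) \<le> length us" for us :: "complex list"
      by (induction us) (auto intro!: order_trans[OF degree_mult_le] simp del: mult_pCons_left)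
    then have "appl ?w (\<Prod>u\<leftarrow>us. [:1, u:]) = 0" if "length us = ?d" for us
      using appl_zero[OF 2] that by metis
    then show ?thesis
      using red by (subst in_P_plus_or_zero_iff[OF degree_V_op]) blast
  qed
qed

section \<open>From (ii) to (iii)\<close>

text \<open>Here \<open>x\<close> is a solution of \<open>u = x / (1 + x\<^sup>2)\<close>.\<close>

lemma V_op_binomial:
  assumes "Re u > 0"
  obtains x where "\<not> (x\<^sup>2 \<in> \<real> \<and> Re (x\<^sup>2) \<le> 0)"
    "poly (V_op \<alpha> n ([:1, 1:] ^ n)) (x\<^sup>2) = 0 \<longleftrightarrow> poly (kernel_poly \<alpha> n) (u\<^sup>2) = 0"
proof -
  have u: "u \<noteq> 0" using assms by auto
  define x where "x = (1 + csqrt (1 - 4 * u\<^sup>2)) / (2 * u)"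
  have "(2 * u * x - 1)\<^sup>2 = 1 - 4 * u\<^sup>2"
    using u by (simp add: x_def)
  then have "4 * u * (u * (1 + x\<^sup>2) - x) = 0"
    by (simp add: algebra_simps power2_eq_square)
  then have xu: "x = u * (1 + x\<^sup>2)"
    using u by simp
  then have x: "x \<noteq> 0" "1 + x\<^sup>2 \<noteq> 0"
    by (metis add.right_neutral mult.right_neutral power_zero_numeral u, metis mult_zero_right add.right_neutral power_zero_numeral zero_neq_one)
  \<comment> \<open>If x^2 = r \<le> 0, then u^2 = r / (1 + r)^2 is non-positive too, against Re u >
    0.\<close>
  have not: "\<not> (x\<^sup>2 \<in> \<real> \<and> Re (x\<^sup>2) \<le> 0)"
  proof
    assume "x\<^sup>2 \<in> \<real> \<and> Re (x\<^sup>2) \<le> 0"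
    then obtain r where r: "x\<^sup>2 = of_real r" "r \<le> 0"
      by (auto elim!: Reals_cases)
    have "u\<^sup>2 = x\<^sup>2 / (1 + x\<^sup>2)\<^sup>2"
      using xu x by (metis nonzero_mult_div_cancel_right power_divide)
    also have "\<dots> = of_real (r / (1 + r)\<^sup>2)"
      by (simp add: r)
    finally have "u\<^sup>2 = of_real (r / (1 + r)\<^sup>2)" .
    moreover have "r / (1 + r)\<^sup>2 \<le> 0"
      using r(2) by (simp add: divide_nonpos_nonneg)
    ultimately show False
      using Re_pos_power2[OF assms] by simp
  qed
  have "[:1 + x\<^sup>2, x:] = smult (1 + x\<^sup>2) [:1, u:]"
    using xu by (simp add: mult.commute)
  then have "[:1 + x\<^sup>2, x:] ^ n = smult ((1 + x\<^sup>2) ^ n) ([:1, u:] ^ n)"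
    by (simp only: smult_power)
  then have "x * poly (V_op \<alpha> n ([:1, 1:] ^ n)) (x\<^sup>2)
    = (1 + x\<^sup>2) ^ n * (fact n * u * poly (kernel_poly \<alpha> n) (u\<^sup>2))"
    using V_op_prod[of "replicate n 1" n x \<alpha> 1]
    by (simp add: appl_smult appl_walk_weight)
  then have "poly (V_op \<alpha> n ([:1, 1:] ^ n)) (x\<^sup>2) = 0 \<longleftrightarrow> poly (kernel_poly \<alpha> n) (u\<^sup>2) = 0"
    using x u by (metis fact_nonzero mult_eq_0_iff power_eq_0_iff)
  then show ?thesis
    using that not by blast
qed

text \<open>A zero u^2 with Re u > 0 would yield a zero x^2 of the image of (1 + z)^n off the
  non-positive reals; if that image is 0, all such u^2 are zeros.\<close>

lemma kernel_poly_in_P_plus: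
  assumes "V_op \<alpha> n ([:1, 1:] ^ n) \<in> P_plus n \<union> {0}"
  shows "kernel_poly \<alpha> n \<in> P_plus n \<union> {0}"
proof (cases "V_op \<alpha> n ([:1, 1:] ^ n) = 0")
  case True
  then have "poly (kernel_poly \<alpha> n) (u\<^sup>2) = 0" if "Re u > 0" for u
    using V_op_binomial[OF that, of \<alpha> n] by force
  then show ?thesis
    using in_P_plus_or_zero_iff[OF degree_kernel_poly] by blast
next
  case False
  then have "poly (kernel_poly \<alpha> n) (u\<^sup>2) \<noteq> 0" if "Re u > 0" for u
    using V_op_binomial[OF that, of \<alpha> n] assms by (fastforce simp: P_plus_def)
  then show ?thesis
    using in_P_plus_or_zero_iff[OF degree_kernel_poly] by blast
qed

lemma binomial_in_P_plus: "[:1, 1:] ^ n \<in> P_plus n"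
proof -
  have "z \<in> \<real> \<and> Re z \<le> 0" if "1 + z = 0" for z :: complex
  proof -
    have "z = - 1"
      using that by (simp add: eq_neg_iff_add_eq_0 add.commute)
    then show ?thesis by simp
  qed
  then show ?thesis
    by (auto simp: P_plus_def degree_linear_power)
qed

theorem theorem4p3:
  fixes \<alpha> :: "nat \<Rightarrow> real" and n :: nat
  shows "(V_op \<alpha> n ` P_plus n \<subseteq> P_plus n \<union> {0}
            \<longleftrightarrow> V_op \<alpha> n ([:1, 1:] ^ n) \<in> P_plus n \<union> {0})
       \<and> (V_op \<alpha> n ([:1, 1:] ^ n) \<in> P_plus n \<union> {0}
            \<longleftrightarrow> (\<Sum>k | int k \<le> \<lfloor>(real n - 1) / 2\<rfloor>.
                  monom (complex_of_real
                    ((\<Sum>j=0..k. \<alpha> j / (fact (k + 1 + j) * fact (k - j))) / fact (n - 2 * k - 1))) k)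
                \<in> P_plus n \<union> {0})"
proof -
  \<comment> \<open>For n = 0 the floor is -1 and both sets are empty.\<close>
  have "{k. int k \<le> \<lfloor>(real n - 1) / 2\<rfloor>} = {k. 2 * k + 1 \<le> n}"
    by (auto simp: le_floor_iff)
  then have kernel: "(\<Sum>k | int k \<le> \<lfloor>(real n - 1) / 2\<rfloor>.
      monom (complex_of_real
        ((\<Sum>j=0..k. \<alpha> j / (fact (k + 1 + j) * fact (k - j))) / fact (n - 2 * k - 1))) k)
      = kernel_poly \<alpha> n"
    unfolding kernel_poly_def by simp
  show ?thesis
    unfolding kernel
  proof (intro conjI iffI)
    assume "V_op \<alpha> n ` P_plus n \<subseteq> P_plus n \<union> {0}"
    then show "V_op \<alpha> n ([:1, 1:] ^ n) \<in> P_plus n \<union> {0}"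
      by (rule subsetD) (rule imageI, rule binomial_in_P_plus)
  next
    assume "V_op \<alpha> n ([:1, 1:] ^ n) \<in> P_plus n \<union> {0}"
    then show "V_op \<alpha> n ` P_plus n \<subseteq> P_plus n \<union> {0}"
      using V_op_P_plus[OF kernel_poly_stable[OF kernel_poly_in_P_plus]] by blast
  next
    assume "V_op \<alpha> n ([:1, 1:] ^ n) \<in> P_plus n \<union> {0}"
    then show "kernel_poly \<alpha> n \<in> P_plus n \<union> {0}"
      by (rule kernel_poly_in_P_plus)
  next
    assume "kernel_poly \<alpha> n \<in> P_plus n \<union> {0}"
    then show "V_op \<alpha> n ([:1, 1:] ^ n) \<in> P_plus n \<union> {0}"
      by (intro V_op_P_plus kernel_poly_stable binomial_in_P_plus)
  qed
qed

end
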